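(* Let $\chi=\{(E_c\cdot\mathcal A\cdot e^{\mathrm j\Phi})_{c\in\mathcal I}\in\mathcal H:\Phi\in\mathbb R^{n\times n}\}$ and $A_\chi=\{(x,x,\dots,x)\in\mathcal H^m: x\in\chi\}$. For any $w=(w_1,w_2,\ldots,w_m)\in\mathcal H^m$, $$P_{A_\chi}(w)=\Big\{\big[(E_c\cdot\mathcal A\cdot e^{\mathrm j\Psi})_{c\in\mathcal I}\big]_m\ :\ \Psi\in\arg\Big(\sum_{c\in\mathcal I}(E_c\cdot\mathcal A\cdot\overline w_c)\Big)\Big\},$$ where $\overline w=(\overline w_c)_{c\in\mathcal I}=\frac1m\sum_{d=1}^m w_d$.
   Context: Let $n,m\ge1$ be integers. Products, exponentials, equalities and arguments of $n\times n$ arrays are elementwise; $\mathrm j=\sqrt{-1}$; indices are $\xi=(\xi_1,\xi_2)$, $1\le\xi_1,\xi_2\le n$, and $w[\xi]$ is the entry of $w$ at $\xi$. The argument is set-valued: for $w\in\mathbb C^{n\times n}$, $\Psi\in\arg(w)$ means $\Psi\in\mathbb R^{n\times n}$ and $w=|w|\cdot e^{\mathrm j\Psi}$ elementwise (so $\Psi[\xi]$ is an arbitrary real number where $w[\xi]=0$). Let $\mathcal I=\{XX,XY,XZ,YX,YY,YZ\}$ and $\mathcal H=(\mathbb C^{n\times n})^6$, with elements $x=(x_c)_{c\in\mathcal I}$, with Frobenius norm $\|x\|^2=\sum_{c\in\mathcal I}\sum_\xi|x_c[\xi]|^2$; $\mathcal H^m$ carries the norm $\|(w_1,\dots,w_m)\|^2=\sum_d\|w_d\|^2$.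 For $x\in\mathcal H$, $[x]_m=(x,x,\dots,x)\in\mathcal H^m$ ($m$ times). For a set $\Omega$, $P_\Omega(x)=\{w\in\Omega:\|x-w\|=\inf_{v\in\Omega}\|x-v\|\}$. $\mathcal A\in\mathbb R_+^{n\times n}$ is a given entrywise nonnegative matrix (the known amplitude of the generalized pupil function). The matrices $E_c$: for every index $\xi$ (sampling point of the lens aperture) let $(k_X,k_Y,k_Z)=(k_X[\xi],k_Y[\xi],k_Z[\xi])\in\mathbb R^3$ be a unit vector (the unit wave vector) with $1+k_Z\neq0$. The real $n\times n$ matrices $E_c$ are given entrywise by $E_{XX}=1-\frac{k_X^2}{1+k_Z}$, $E_{XY}=E_{YX}=-\frac{k_Xk_Y}{1+k_Z}$, $E_{YY}=1-\frac{k_Y^2}{1+k_Z}$, $E_{XZ}=-k_X$, $E_{YZ}=-k_Y$; they satisfy $\sum_{c\in\mathcal I}E_c^2=2$ in every entry. *)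

theory Defs
  imports "HOL-Analysis.Analysis"
begin

text \<open>
  An \<open>n \<times> n\<close> array has type \<^typ>\<open>complex ^ 'n ^ 'n\<close> or \<^typ>\<open>real ^ 'n ^ 'n\<close>, with
  \<open>n = CARD('n)\<close>; its entry at \<open>\<xi> = (\<xi>\<^sub>1, \<xi>\<^sub>2)\<close> is \<open>w $ \<xi>\<^sub>1 $ \<xi>\<^sub>2\<close>. The product
  \<open>*\<close> on these types is elementwise (the matrix product is \<open>**\<close>).
\<close>

datatype channel = XX | XY | XZ | YX | YY | YZ

lemma UNIV_channel: "(UNIV :: channel set) = {XX, XY, XZ, YX, YY, YZ}"
  using channel.exhaust by blast

instance channel :: finite
  by standard (simp add: UNIV_channel)

text \<open>
  The space \<open>\<H>\<close> is \<^typ>\<open>complex ^ 'n ^ 'n ^ channel\<close> and \<open>\<H>\<^sup>m\<close> is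
  \<^typ>\<open>complex ^ 'n ^ 'n ^ channel ^ 'm\<close> with \<open>m = CARD('m)\<close>. The library norm on these types
  is the Frobenius norm; see \<open>norm_H\<close> and \<open>norm_Hm\<close>.
\<close>

lemma norm_vec_power2: "(norm x)\<^sup>2 = (\<Sum>i\<in>UNIV. (norm (x $ i))\<^sup>2)"
  by (simp add: norm_vec_def L2_set_def sum_nonneg)

lemma norm_H:
  fixes x :: "complex ^ 'n ^ 'n ^ channel"
  shows "(norm x)\<^sup>2 = (\<Sum>c\<in>UNIV. \<Sum>a\<in>UNIV. \<Sum>b\<in>UNIV. (cmod (x $ c $ a $ b))\<^sup>2)"
  by (simp add: norm_vec_power2)

lemma norm_Hm:
  fixes w :: "complex ^ 'n ^ 'n ^ channel ^ 'm"
  shows "(norm w)\<^sup>2 = (\<Sum>d\<in>UNIV. (norm (w $ d))\<^sup>2)"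
  by (rule norm_vec_power2)

definition of_real_array :: "real ^ 'n ^ 'n \<Rightarrow> complex ^ 'n ^ 'n" where
  "of_real_array A = (\<chi> a b. complex_of_real (A $ a $ b))"

definition abs_array :: "complex ^ 'n ^ 'n \<Rightarrow> real ^ 'n ^ 'n" where
  "abs_array w = (\<chi> a b. cmod (w $ a $ b))"

definition expj :: "real ^ 'n ^ 'n \<Rightarrow> complex ^ 'n ^ 'n" where
  "expj \<Phi> = (\<chi> a b. exp (\<i> * complex_of_real (\<Phi> $ a $ b)))"

text \<open>The set-valued argument; no normalization of the phase, and any real value where \<open>w\<close> vanishes.\<close>

definition arg_array :: "complex ^ 'n ^ 'n \<Rightarrow> (real ^ 'n ^ 'n) set" where
  "arg_array w = {\<Psi>. w = of_real_array (abs_array w) * expj \<Psi>}"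

text \<open>\<open>k $ \<xi>\<^sub>1 $ \<xi>\<^sub>2\<close> is the wave vector \<open>(k\<^sub>X, k\<^sub>Y, k\<^sub>Z)\<close> at the sampling point \<open>\<xi>\<close>.\<close>

fun E_entry :: "real ^ 3 \<Rightarrow> channel \<Rightarrow> real" where
  "E_entry v XX = 1 - (v $ 1)\<^sup>2 / (1 + v $ 3)"
| "E_entry v XY = - (v $ 1 * v $ 2) / (1 + v $ 3)"
| "E_entry v YX = - (v $ 1 * v $ 2) / (1 + v $ 3)"
| "E_entry v YY = 1 - (v $ 2)\<^sup>2 / (1 + v $ 3)"
| "E_entry v XZ = - v $ 1"
| "E_entry v YZ = - v $ 2"

definition E :: "real ^ 3 ^ 'n ^ 'n \<Rightarrow> channel \<Rightarrow> real ^ 'n ^ 'n" where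
  "E k c = (\<chi> a b. E_entry (k $ a $ b) c)"

definition unit_wave_vectors :: "real ^ 3 ^ 'n ^ 'n \<Rightarrow> bool" where
  "unit_wave_vectors k \<longleftrightarrow> (\<forall>a b. norm (k $ a $ b) = 1 \<and> 1 + k $ a $ b $ 3 \<noteq> 0)"

lemma sum_E_squared:
  assumes "unit_wave_vectors k"
  shows "(\<Sum>c\<in>UNIV. (E k c $ a $ b)\<^sup>2) = 2"
proof -
  define x y z where "x = k $ a $ b $ 1" "y = k $ a $ b $ 2" "z = k $ a $ b $ 3"
  have "(norm (k $ a $ b))\<^sup>2 = 1" and nz: "1 + z \<noteq> 0"
    using assms by (simp_all add: unit_wave_vectors_def x_y_z_def)
  then have "x\<^sup>2 + y\<^sup>2 + z\<^sup>2 = 1"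
    by (simp add: norm_vec_power2 sum_3 x_y_z_def)
  then have s: "x\<^sup>2 + y\<^sup>2 = (1 - z) * (1 + z)"
    by (simp add: algebra_simps power2_eq_square)
  define t where "t = 1 / (1 + z)"
  have t: "t * (x\<^sup>2 + y\<^sup>2) = 1 - z" using nz by (simp add: s t_def)
  have "(\<Sum>c\<in>UNIV. (E k c $ a $ b)\<^sup>2) =
      (1 - t * x\<^sup>2)\<^sup>2 + 2 * (t * x * y)\<^sup>2 + (1 - t * y\<^sup>2)\<^sup>2 + (x\<^sup>2 + y\<^sup>2)"
    by (simp add: UNIV_channel E_def t_def power_mult_distrib power_divide flip: x_y_z_def)
  also have "\<dots> = 2 - 2 * (t * (x\<^sup>2 + y\<^sup>2)) + (t * (x\<^sup>2 + y\<^sup>2))\<^sup>2 + (x\<^sup>2 + y\<^sup>2)"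
    by (simp add: algebra_simps power2_eq_square)
  also have "\<dots> = 2"
    unfolding t by (subst s) (simp add: algebra_simps power2_eq_square)
  finally show ?thesis .
qed

definition pupil :: "real ^ 3 ^ 'n ^ 'n \<Rightarrow> real ^ 'n ^ 'n \<Rightarrow> real ^ 'n ^ 'n
    \<Rightarrow> complex ^ 'n ^ 'n ^ channel" where
  "pupil k A \<Phi> = (\<chi> c. of_real_array (E k c) * of_real_array A * expj \<Phi>)"

definition chi_set :: "real ^ 3 ^ 'n ^ 'n \<Rightarrow> real ^ 'n ^ 'n \<Rightarrow> (complex ^ 'n ^ 'n ^ channel) set" where
  "chi_set k A = {pupil k A \<Phi> | \<Phi>. True}"

text \<open>The tuple \<open>[x]\<^sub>m = (x, \<dots>, x)\<close>.\<close>

definition diag :: "'a \<Rightarrow> 'a ^ 'm" where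
  "diag x = (\<chi> d. x)"

definition A_chi :: "real ^ 3 ^ 'n ^ 'n \<Rightarrow> real ^ 'n ^ 'n
    \<Rightarrow> (complex ^ 'n ^ 'n ^ channel ^ 'm) set" where
  "A_chi k A = {diag x | x. x \<in> chi_set k A}"

definition proj :: "'a::real_normed_vector set \<Rightarrow> 'a \<Rightarrow> 'a set" where
  "proj \<Omega> x = {w \<in> \<Omega>. norm (x - w) = (INF v\<in>\<Omega>. norm (x - v))}"

definition mean :: "'a::real_vector ^ 'm \<Rightarrow> 'a" where
  "mean w = (1 / real CARD('m)) *\<^sub>R (\<Sum>d\<in>UNIV. w $ d)"

end

theory Submission
  imports Defs
begin

text \<open>
  The idea is that all points of \<open>A_chi k A\<close> have the same norm, because \<open>\<Sum>c. (E k c)\<^sup>2 = 2\<close> in every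
  entry (\<open>norm_pupil\<close>). Expanding the square of the distance from \<open>w\<close> to a point of that set shows
  that a nearest point is the same thing as a point with the largest inner product with \<open>w\<close>.
  The inner product with a constant tuple sees \<open>w\<close> only through its mean, and since the factors
  \<open>E k c\<close> and \<open>A\<close> are real they can be moved to the other side, so that up to the factor \<open>m\<close> it
  equals \<open>S \<bullet> expj \<Phi>\<close>, where \<open>S\<close> is the weighted sum of the channels of \<open>mean w\<close>
  (\<open>inner_diag\<close>, \<open>inner_pupil\<close>).
  The entries of \<open>expj \<Phi>\<close> have modulus one, so by the Cauchy--Schwarz inequality in each entry
  \<open>S \<bullet> expj \<Phi>\<close> is at most the sum of the moduli of the entries of \<open>S\<close>, with equality exactly
  when \<open>\<Phi>\<close> is an argument of \<open>S\<close> (\<open>inner_expj_le\<close>, \<open>inner_expj_eq_iff\<close>). As every array has an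
  argument, this bound is attained, and the maximizers are the arguments of \<open>S\<close>.
\<close>

text \<open>
  The set of distances is bounded below by zero, and it is nonempty as soon as a candidate \<open>y\<close> is
  given; so the real infimum has its usual meaning and a point attaining it is a closest point.
\<close>
lemma mem_proj_iff:
  "y \<in> proj \<Omega> x \<longleftrightarrow> y \<in> \<Omega> \<and> (\<forall>v\<in>\<Omega>. norm (x - y) \<le> norm (x - v))"
proof -
  have bdd: "bdd_below ((\<lambda>v. norm (x - v)) ` \<Omega>)"
    by (rule bdd_belowI2[where m = 0]) simp
  have "norm (x - y) = (INF v\<in>\<Omega>. norm (x - v))"
    if "y \<in> \<Omega>" "\<forall>v\<in>\<Omega>. norm (x - y) \<le> norm (x - v)"
    using that by (intro antisym cINF_greatest cINF_lower bdd) auto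
  moreover have "norm (x - y) \<le> norm (x - v)"
    if "norm (x - y) = (INF u\<in>\<Omega>. norm (x - u))" "v \<in> \<Omega>" for v
    using cINF_lower[OF bdd \<open>v \<in> \<Omega>\<close>] that(1) by simp
  ultimately show ?thesis
    by (auto simp: proj_def)
qed

lemma norm_diff_le_iff_inner_ge:
  fixes x y z :: "'a::real_inner"
  assumes "norm y = norm z"
  shows "norm (x - y) \<le> norm (x - z) \<longleftrightarrow> x \<bullet> z \<le> x \<bullet> y"
proof -
  have "y \<bullet> y = z \<bullet> z"
    using assms by (simp flip: power2_norm_eq_inner)
  then show ?thesis
    by (simp add: norm_le inner_diff_left inner_diff_right inner_commute)
qed

lemma inner_diag:
  fixes w :: "'a::real_inner ^ 'm"
  shows "w \<bullet> diag x = real CARD('m) * (mean w \<bullet> x)"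
  by (simp add: inner_vec_def diag_def mean_def inner_sum_left)

lemma norm_diag:
  fixes x :: "'a::real_inner"
  shows "(norm (diag x :: 'a ^ 'm))\<^sup>2 = real CARD('m) * (norm x)\<^sup>2"
  by (simp add: norm_vec_power2 diag_def)

lemma expj_nth: "expj \<Phi> $ a $ b = cis (\<Phi> $ a $ b)"
  by (simp add: expj_def cis_conv_exp)

text \<open>
  The real weights are self-adjoint for the real inner product of \<open>complex\<close>, which moves them from
  the exponential to the other argument; summing over the channels then leaves one array.
\<close>
lemma inner_pupil:
  "v \<bullet> pupil k A \<Phi> =
    (\<Sum>c\<in>UNIV. of_real_array (E k c) * of_real_array A * v $ c) \<bullet> expj \<Phi>"
proof -
  have "z \<bullet> (of_real r * of_real s * e) = (of_real r * of_real s * z) \<bullet> e"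
    for z e :: complex and r s
    by (simp add: inner_complex_def algebra_simps)
  then have "v $ c \<bullet> (of_real_array (E k c) * of_real_array A * expj \<Phi>) =
      (of_real_array (E k c) * of_real_array A * v $ c) \<bullet> expj \<Phi>" for c
    by (simp add: inner_vec_def of_real_array_def)
  then show ?thesis
    by (simp add: inner_vec_def[of v] pupil_def inner_sum_left)
qed

lemma norm_pupil:
  assumes "unit_wave_vectors k"
  shows "(norm (pupil k A \<Phi>))\<^sup>2 = 2 * (norm A)\<^sup>2"
proof -
  have "(norm (pupil k A \<Phi>))\<^sup>2 =
      (\<Sum>c\<in>UNIV. \<Sum>a\<in>UNIV. \<Sum>b\<in>UNIV. (E k c $ a $ b)\<^sup>2 * (A $ a $ b)\<^sup>2)"
    by (simp add: norm_H pupil_def of_real_array_def expj_nth norm_mult power_mult_distrib)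
  also have "\<dots> = (\<Sum>a\<in>UNIV. \<Sum>b\<in>UNIV. \<Sum>c\<in>UNIV. (E k c $ a $ b)\<^sup>2 * (A $ a $ b)\<^sup>2)"
    by (subst sum.swap, intro sum.cong refl, rule sum.swap)
  also have "\<dots> = (\<Sum>a\<in>UNIV. \<Sum>b\<in>UNIV. 2 * (A $ a $ b)\<^sup>2)"
    by (simp add: sum_E_squared[OF assms] flip: sum_distrib_right)
  also have "\<dots> = 2 * (norm A)\<^sup>2"
    by (simp add: norm_vec_power2 sum_distrib_left)
  finally show ?thesis .
qed

lemma inner_cis_le: "z \<bullet> cis t \<le> cmod z"
  using norm_cauchy_schwarz[of z "cis t"] by simp

lemma inner_cis_eq_iff: "z \<bullet> cis t = cmod z \<longleftrightarrow> z = of_real (cmod z) * cis t"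
  using norm_cauchy_schwarz_eq[of z "cis t"] by (auto simp: scaleR_conv_of_real)

lemma mem_arg_array_iff:
  "\<Psi> \<in> arg_array S \<longleftrightarrow>
    (\<forall>a b. S $ a $ b = of_real (cmod (S $ a $ b)) * cis (\<Psi> $ a $ b))"
  by (simp add: arg_array_def vec_eq_iff of_real_array_def abs_array_def expj_nth)

lemma arg_array_nonempty: "\<exists>\<Psi>. \<Psi> \<in> arg_array S"
proof
  show "(\<chi> a b. Arg (S $ a $ b)) \<in> arg_array S"
    using rcis_cmod_Arg by (simp add: mem_arg_array_iff rcis_def)
qed

lemma inner_expj_le: "S \<bullet> expj \<Phi> \<le> (\<Sum>a\<in>UNIV. \<Sum>b\<in>UNIV. cmod (S $ a $ b))"
  by (simp add: inner_vec_def expj_nth sum_mono inner_cis_le)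

text \<open>
  A sum of entrywise inequalities is an equality only if each of them is, and equality in the
  Cauchy--Schwarz inequality with a unit vector says that this vector is the phase of the entry;
  where the entry vanishes this is no constraint, which matches the set-valued argument.
\<close>
lemma inner_expj_eq_iff:
  "S \<bullet> expj \<Phi> = (\<Sum>a\<in>UNIV. \<Sum>b\<in>UNIV. cmod (S $ a $ b)) \<longleftrightarrow> \<Phi> \<in> arg_array S"
proof -
  have "S \<bullet> expj \<Phi> = (\<Sum>a\<in>UNIV. \<Sum>b\<in>UNIV. cmod (S $ a $ b)) \<longleftrightarrow>
      (\<Sum>a\<in>UNIV. \<Sum>b\<in>UNIV. cmod (S $ a $ b) - S $ a $ b \<bullet> cis (\<Phi> $ a $ b)) = 0"
    by (auto simp: inner_vec_def expj_nth sum_subtractf)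
  also have "\<dots> \<longleftrightarrow> (\<forall>a b. cmod (S $ a $ b) = S $ a $ b \<bullet> cis (\<Phi> $ a $ b))"
    by (simp add: sum_nonneg_eq_0_iff sum_nonneg inner_cis_le)
  finally show ?thesis
    by (simp only: eq_commute[of "cmod _"] inner_cis_eq_iff mem_arg_array_iff)
qed

theorem lemma3p9:
  fixes k :: "real ^ 3 ^ 'n ^ 'n"
    and A :: "real ^ 'n ^ 'n"
    and w :: "complex ^ 'n ^ 'n ^ channel ^ 'm"
  assumes "unit_wave_vectors k"
    and "\<And>a b. 0 \<le> A $ a $ b"
  shows "proj (A_chi k A) w =
    {diag (pupil k A \<Psi>) | \<Psi>.
       \<Psi> \<in> arg_array (\<Sum>c\<in>UNIV. of_real_array (E k c) * of_real_array A * mean w $ c)}"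
proof -
  define S where "S = (\<Sum>c\<in>UNIV. of_real_array (E k c) * of_real_array A * mean w $ c)"
  let ?p = "\<lambda>\<Phi>. diag (pupil k A \<Phi>) :: complex ^ 'n ^ 'n ^ channel ^ 'm"
  have A_chi: "A_chi k A = range ?p"
    by (auto simp: A_chi_def chi_set_def)
  have "(norm (?p \<Phi>))\<^sup>2 = (norm (?p \<Psi>))\<^sup>2" for \<Phi> \<Psi>
    by (simp add: norm_diag norm_pupil[OF assms(1)])
  then have same_norm: "norm (?p \<Phi>) = norm (?p \<Psi>)" for \<Phi> \<Psi>
    by (simp add: power2_eq_iff_nonneg)
  have closer: "norm (w - ?p \<Phi>) \<le> norm (w - ?p \<Psi>) \<longleftrightarrow> S \<bullet> expj \<Psi> \<le> S \<bullet> expj \<Phi>" for \<Phi> \<Psi>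
    by (simp add: norm_diff_le_iff_inner_ge[OF same_norm] inner_diag inner_pupil S_def)
  obtain \<Theta> where \<Theta>: "\<Theta> \<in> arg_array S"
    using arg_array_nonempty by blast
  have "(\<forall>\<Psi>. S \<bullet> expj \<Psi> \<le> S \<bullet> expj \<Phi>) \<longleftrightarrow> \<Phi> \<in> arg_array S" for \<Phi>
    using \<Theta> inner_expj_le[of S] by (metis inner_expj_eq_iff order_antisym)
  then have "?p \<Phi> \<in> proj (A_chi k A) w \<longleftrightarrow> \<Phi> \<in> arg_array S" for \<Phi>
    by (simp add: mem_proj_iff A_chi closer)
  moreover have "proj (A_chi k A) w \<subseteq> range ?p"
    unfolding A_chi by (auto simp: proj_def)
  ultimately show ?thesis
    unfolding S_def[symmetric] by blast
qed

end
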